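(* There is a family $\mathcal F$ of finite subsets of $\omega_1$ such that every finite subset of $\omega_1$ is contained in some member of $\mathcal F$, and $\mathcal F$ has VC-dimension $2$.
   Context: For a set $X$ and $\mathcal F\subseteq\mathcal P(X)$, a subset $A\subseteq X$ is shattered by $\mathcal F$ if for every $S\subseteq A$ there is $F\in\mathcal F$ with $F\cap A=S$. The VC-dimension of $\mathcal F$ is the smallest $n$ such that no subset of $X$ of size $n+1$ is shattered by $\mathcal F$ (and $\infty$ if no such $n$ exists). *)

theory Defs
  imports Main "HOL-Library.Extended_Nat" "HOL-Library.Countable_Set"
begin

definition shattered :: "'a set set \<Rightarrow> 'a set \<Rightarrow> bool" where
  "shattered F A \<longleftrightarrow> (\<forall>S. S \<subseteq> A \<longrightarrow> (\<exists>B\<in>F. B \<inter> A = S))"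

definition vc_dim :: "'a set \<Rightarrow> 'a set set \<Rightarrow> enat" where
  "vc_dim X F =
    (if \<exists>n. \<not> (\<exists>A\<subseteq>X. finite A \<and> card A = n + 1 \<and> shattered F A)
     then enat (LEAST n. \<not> (\<exists>A\<subseteq>X. finite A \<and> card A = n + 1 \<and> shattered F A))
     else \<infinity>)"

text \<open>
  The ordinal \<open>\<omega>\<^sub>1\<close>, realised as the carrier of the library's cardinal successor of
  \<open>natLeq\<close>, i.e. of a well-order that is minimal among those of cardinality greater than
  \<open>\<aleph>\<^sub>0\<close>. That its points happen to be sets of naturals is an artefact of the type
  of \<open>cardSuc\<close>. The two lemmas below pin down the order type: the carrier is uncountable and
  all its proper initial segments are countable.
\<close>

definition omega1 :: "nat set set" where
  "omega1 = Field (cardSuc natLeq)"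

lemma uncountable_omega1:
  includes cardinal_syntax
  shows "uncountable omega1"
proof
  assume "countable omega1"
  then obtain f :: "nat set \<Rightarrow> nat" where "inj_on f omega1"
    by (auto simp: countable_def)
  then have "|omega1| \<le>o |UNIV :: nat set|"
    using card_of_ordLeq[of omega1 "UNIV :: nat set"] by blast
  moreover have "|omega1| =o cardSuc natLeq"
    unfolding omega1_def
    by (intro card_of_Field_ordIso cardSuc_Card_order natLeq_Card_order)
  moreover have "|UNIV :: nat set| =o natLeq"
    by (rule card_of_nat)
  ultimately have "cardSuc natLeq \<le>o natLeq"
    by (meson ordIso_ordLeq_trans ordIso_symmetric ordLeq_ordIso_trans)
  with cardSuc_greater[OF natLeq_Card_order] show False
    using not_ordLess_ordLeq by blast
qed

lemma countable_initial_segment_omega1: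
  includes cardinal_syntax
  assumes "a \<in> omega1"
  shows "countable (underS (cardSuc natLeq) a)"
proof -
  have "|underS (cardSuc natLeq) a| <o cardSuc natLeq"
    using assms unfolding omega1_def
    by (intro card_of_underS cardSuc_Card_order natLeq_Card_order)
  then have "|underS (cardSuc natLeq) a| \<le>o natLeq"
    using cardSuc_ordLeq_ordLess[OF natLeq_Card_order card_of_Card_order] by blast
  then have "|underS (cardSuc natLeq) a| \<le>o |UNIV :: nat set|"
    by (meson card_of_nat ordIso_symmetric ordLeq_ordIso_trans)
  then obtain f :: "nat set \<Rightarrow> nat" where "inj_on f (underS (cardSuc natLeq) a)"
    using card_of_ordLeq[of "underS (cardSuc natLeq) a" "UNIV :: nat set"] by blast
  then show ?thesis
    by (rule countableI)
qed

end

theory Submission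
  imports Defs
begin

text \<open>
  By recursion on \<open>y \<in> \<omega>\<^sub>1\<close> one builds finite sets \<open>H y 0 \<subseteq> H y 1 \<subseteq> \<dots>\<close> with union
  \<open>{x. x \<le> y}\<close> that are coherent: \<open>z \<in> H y n\<close> implies \<open>H y n \<inter> {x. x \<le> z} = H z n\<close>
  (in the language of ordinal metrics, \<open>H y n = {x \<le> y. \<rho> x y \<le> n}\<close>).
  For the step at \<open>y\<close>, enumerate \<open>{x. x < y}\<close> and let \<open>g k\<close> be the greatest of its first \<open>k + 1\<close>
  elements. From some level on, all of these elements lie in \<open>H (g k)\<close>. The sets \<open>H (g k) n\<close> with
  \<open>k \<le> n\<close> for which this is the case from level \<open>n\<close> on form a chain, and \<open>H y n\<close> is its union
  together with \<open>y\<close>.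
  The sets \<open>H y n\<close> are cofinal among the finite sets. If \<open>c\<close> is the largest element of a
  three-element set, then by coherence the traces below \<open>c\<close> of the members
  containing \<open>c\<close> are the sets \<open>H c n\<close>, which form a chain, so the set is not shattered.
  A shattered pair is \<open>{a, b}\<close> with infinitely many elements below \<open>b\<close> and \<open>a < b\<close> outside \<open>H b 0\<close>.
\<close>

section \<open>Shattered sets and VC-dimension\<close>

lemma shattered_subset:
  assumes "shattered F A" and "C \<subseteq> A"
  shows "shattered F C"
  unfolding shattered_def
proof (intro allI impI)
  fix S assume "S \<subseteq> C"
  then obtain B where "B \<in> F" "B \<inter> A = S"
    using assms unfolding shattered_def by blast
  with \<open>S \<subseteq> C\<close> \<open>C \<subseteq> A\<close> show "\<exists>B\<in>F. B \<inter> C = S" by blast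
qed

lemma shattered_iff_Pow_subset: "shattered F A \<longleftrightarrow> Pow A \<subseteq> (\<lambda>B. B \<inter> A) ` F"
  by (auto simp: shattered_def image_iff subset_iff)

lemma not_shattered_if_chain_traces:
  assumes chain: "chain\<^sub>\<subseteq> ((\<lambda>B. B \<inter> A) ` {B \<in> F. c \<in> B})"
    and "c \<in> A" "2 < card A"
  shows "\<not> shattered F A"
proof
  assume shattered: "shattered F A"
  have "\<not> card (A - {c}) \<le> Suc 0"
    using \<open>c \<in> A\<close> \<open>2 < card A\<close> by simp
  then obtain x y where distinct: "x \<in> A - {c}" "y \<in> A - {c}" "x \<noteq> y"
    by (metis card_le_Suc0_iff_eq card.infinite le0)
  then have "{c, x} \<subseteq> A" "{c, y} \<subseteq> A" using \<open>c \<in> A\<close> by auto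
  then obtain B C where "B \<in> F" "C \<in> F"
    and B_trace: "B \<inter> A = {c, x}" and C_trace: "C \<inter> A = {c, y}"
    using shattered unfolding shattered_def by metis
  have "c \<in> B" "c \<in> C" using B_trace C_trace by blast+
  then have "B \<inter> A \<subseteq> C \<inter> A \<or> C \<inter> A \<subseteq> B \<inter> A"
    using chain \<open>B \<in> F\<close> \<open>C \<in> F\<close> by (simp add: chain_subset_def)
  then show False using distinct unfolding B_trace C_trace by blast
qed

lemma vc_dim_eqI:
  assumes "A \<subseteq> X" "finite A" "card A = n" "shattered F A"
    and none: "\<And>C. C \<subseteq> X \<Longrightarrow> finite C \<Longrightarrow> card C = Suc n \<Longrightarrow> \<not> shattered F C"
  shows "vc_dim X F = enat n"
proof -
  let ?P = "\<lambda>n. \<not> (\<exists>A\<subseteq>X. finite A \<and> card A = n + 1 \<and> shattered F A)"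
  have "?P n" using none by auto
  moreover have "n \<le> m" if "?P m" for m
  proof (rule ccontr)
    assume "\<not> n \<le> m"
    then have "m + 1 \<le> card A" using \<open>card A = n\<close> by simp
    then obtain C where "C \<subseteq> A" "card C = m + 1" "finite C"
      by (rule obtain_subset_with_card_n)
    with \<open>?P m\<close> shattered_subset[OF \<open>shattered F A\<close>] \<open>A \<subseteq> X\<close> show False by blast
  qed
  ultimately have "(LEAST n. ?P n) = n" by (rule Least_equality)
  then show ?thesis using \<open>?P n\<close> unfolding vc_dim_def by (subst if_P) blast+
qed

section \<open>Chains and well-orders\<close>

lemma chain_subset_imageI:
  assumes "\<And>x y. x \<in> A \<Longrightarrow> y \<in> A \<Longrightarrow> f x \<subseteq> f y \<or> f y \<subseteq> f x"
  shows "chain\<^sub>\<subseteq> (f ` A)"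
  using assms by (auto simp: chain_subset_def)

lemma eventually_finite_subset_mono_Union:
  fixes C :: "nat \<Rightarrow> 'a set"
  assumes "mono C" "finite A" "A \<subseteq> (\<Union>n. C n)"
  shows "\<forall>\<^sub>F n in sequentially. A \<subseteq> C n"
proof -
  have "\<forall>\<^sub>F n in sequentially. x \<in> C n" if "x \<in> A" for x
  proof -
    from that assms(3) obtain m where "x \<in> C m" by blast
    then have "x \<in> C n" if "m \<le> n" for n using monoD[OF \<open>mono C\<close> that] by blast
    then show ?thesis by (auto simp: eventually_sequentially)
  qed
  then have "\<forall>\<^sub>F n in sequentially. \<forall>x\<in>A. x \<in> C n"
    using \<open>finite A\<close> by (simp add: eventually_ball_finite)
  then show ?thesis by (simp add: subset_eq)
qed

context wo_rel
begin

lemma finite_has_greatest: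
  assumes "finite A" "A \<noteq> {}" "A \<subseteq> Field r"
  shows "\<exists>c\<in>A. A \<subseteq> under c"
proof -
  have "transp_on A (\<lambda>x y. (x, y) \<in> r)"
    using TRANS by (auto intro: transp_onI dest: transD)
  moreover have "totalp_on A (\<lambda>x y. (x, y) \<in> r)"
    using TOTALS \<open>A \<subseteq> Field r\<close> by (intro totalp_onI) blast
  ultimately obtain c where "c \<in> A" "\<forall>x\<in>A. x \<noteq> c \<longrightarrow> (x, c) \<in> r"
    using Finite_Set.bex_greatest_element[OF assms(1,2)] by blast
  moreover have "(c, c) \<in> r" using TOTALS \<open>c \<in> A\<close> \<open>A \<subseteq> Field r\<close> by blast
  ultimately show ?thesis by (auto simp: under_def)
qed

lemma countable_Field_if_finite_under:
  assumes "\<And>b. b \<in> Field r \<Longrightarrow> finite (under b)"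
  shows "countable (Field r)"
proof (rule countableI)
  have less: "card (under a) < card (under b)" if "(a, b) \<in> r" "a \<noteq> b" for a b
  proof (rule psubset_card_mono)
    have "b \<in> Field r" using \<open>(a, b) \<in> r\<close> by (simp add: FieldI2)
    then show "finite (under b)" by (rule assms)
    have "b \<notin> under a" using that ANTISYM by (auto simp: under_def dest: antisymD)
    moreover have "b \<in> under b" using \<open>b \<in> Field r\<close> by (rule Refl_under_in[OF REFL])
    ultimately show "under a \<subset> under b" using under_incr[OF TRANS \<open>(a, b) \<in> r\<close>] by blast
  qed
  show "inj_on (\<lambda>b. card (under b)) (Field r)"
  proof (rule inj_onI, rule ccontr)
    fix a b assume "a \<in> Field r" "b \<in> Field r" "card (under a) = card (under b)" "a \<noteq> b"
    then show False using less[of a b] less[of b a] TOTALS by auto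
  qed
qed

end

section \<open>Coherent exhaustions\<close>

definition coherent :: "'a rel \<Rightarrow> ('a \<Rightarrow> nat \<Rightarrow> 'a set) \<Rightarrow> nat \<Rightarrow> 'a set \<Rightarrow> bool" where
  "coherent r H n B \<longleftrightarrow> (\<forall>z\<in>B. B \<inter> under r z = H z n)"

definition coherent_exhaustion ::
    "'a rel \<Rightarrow> ('a \<Rightarrow> nat \<Rightarrow> 'a set) \<Rightarrow> 'a set \<Rightarrow> (nat \<Rightarrow> 'a set) \<Rightarrow> bool" where
  "coherent_exhaustion r H D C \<longleftrightarrow>
     mono C \<and> (\<Union>n. C n) = D \<and> (\<forall>n. finite (C n)) \<and> (\<forall>n. coherent r H n (C n))"

lemma coherentD: "coherent r H n B \<Longrightarrow> z \<in> B \<Longrightarrow> B \<inter> under r z = H z n"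
  by (simp add: coherent_def)

lemma coherent_imp_level_subset: "coherent r H n B \<Longrightarrow> z \<in> B \<Longrightarrow> H z n \<subseteq> B"
  using coherentD by fastforce

lemma coherent_Union_chain:
  assumes "chain\<^sub>\<subseteq> \<A>" and coherent: "\<And>B. B \<in> \<A> \<Longrightarrow> coherent r H n B"
  shows "coherent r H n (\<Union>\<A>)"
  unfolding coherent_def
proof
  fix z assume "z \<in> \<Union>\<A>"
  then obtain B where "B \<in> \<A>" "z \<in> B" by blast
  have "w \<in> H z n" if "w \<in> C" "C \<in> \<A>" "w \<in> under r z" for w C
  proof -
    have "B \<subseteq> C \<or> C \<subseteq> B" using assms(1) \<open>B \<in> \<A>\<close> \<open>C \<in> \<A>\<close> by (simp add: chain_subset_def)
    then obtain E where "E \<in> \<A>" "w \<in> E" "z \<in> E"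
      using \<open>B \<in> \<A>\<close> \<open>z \<in> B\<close> \<open>w \<in> C\<close> \<open>C \<in> \<A>\<close> by blast
    then show ?thesis using coherentD[OF coherent] \<open>w \<in> under r z\<close> by blast
  qed
  moreover have "B \<inter> under r z = H z n" using coherentD[OF coherent] \<open>B \<in> \<A>\<close> \<open>z \<in> B\<close> by blast
  ultimately show "\<Union>\<A> \<inter> under r z = H z n" using \<open>B \<in> \<A>\<close> by blast
qed

lemma coherent_exhaustion_cong:
  assumes "\<And>x. x \<in> D \<Longrightarrow> H x = H' x"
  shows "coherent_exhaustion r H D = coherent_exhaustion r H' D"
proof
  fix C
  have "coherent r H n (C n) \<longleftrightarrow> coherent r H' n (C n)" if "(\<Union>n. C n) = D" for n
    using assms that unfolding coherent_def by (metis UN_I UNIV_I)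
  then show "coherent_exhaustion r H D C = coherent_exhaustion r H' D C"
    unfolding coherent_exhaustion_def by blast
qed

lemma coherent_exhaustion_UN:
  assumes exhaust: "\<And>k. coherent_exhaustion r H (E k) (K k)"
    and increasing: "\<And>j k n. j \<le> k \<Longrightarrow> N k \<le> n \<Longrightarrow> K j n \<subseteq> K k n"
  shows "coherent_exhaustion r H (\<Union>k. E k) (\<lambda>n. \<Union>k\<in>{k. k \<le> n \<and> N k \<le> n}. K k n)"
proof -
  have mono: "mono (K k)" and Union: "(\<Union>n. K k n) = E k" and finite: "finite (K k n)"
    and coherent: "coherent r H n (K k n)" for k n
    using exhaust by (simp_all add: coherent_exhaustion_def)
  define I where "I n = {k. k \<le> n \<and> N k \<le> n}" for n
  have "coherent_exhaustion r H (\<Union>k. E k) (\<lambda>n. \<Union>k\<in>I n. K k n)"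
    unfolding coherent_exhaustion_def
  proof (intro conjI allI)
    show "mono (\<lambda>n. \<Union>k\<in>I n. K k n)"
    proof (rule monoI)
      fix m n :: nat assume "m \<le> n"
      then have "I m \<subseteq> I n" by (auto simp: I_def)
      then show "(\<Union>k\<in>I m. K k m) \<subseteq> (\<Union>k\<in>I n. K k n)"
        using monoD[OF mono \<open>m \<le> n\<close>] by (rule UN_mono)
    qed
    have "x \<in> (\<Union>n. \<Union>k\<in>I n. K k n)" if "x \<in> K k m" for x k m
    proof -
      define n where "n = m + k + N k"
      have "x \<in> K k n" using that monoD[OF mono, of m n k] by (auto simp: n_def)
      moreover have "k \<in> I n" by (simp add: I_def n_def)
      ultimately show ?thesis by blast
    qed
    then show "(\<Union>n. \<Union>k\<in>I n. K k n) = (\<Union>k. E k)"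
      unfolding Union[symmetric] by blast
    show "finite (\<Union>k\<in>I n. K k n)" for n using finite by (simp add: I_def)
    show "coherent r H n (\<Union>k\<in>I n. K k n)" for n
    proof (rule coherent_Union_chain)
      have "K j n \<subseteq> K k n \<or> K k n \<subseteq> K j n" if "j \<in> I n" "k \<in> I n" for j k
        using increasing that by (cases j k rule: le_cases) (auto simp: I_def)
      then show "chain\<^sub>\<subseteq> ((\<lambda>k. K k n) ` I n)" by (rule chain_subset_imageI)
    qed (use coherent in auto)
  qed
  then show ?thesis by (simp only: I_def)
qed

context wo_rel
begin

lemma coherent_exhaustion_eventually_subset:
  assumes exhaust: "\<And>x. x \<in> D \<Longrightarrow> coherent_exhaustion r H (under x) (H x)"
    and "D \<subseteq> Field r" "finite A" "A \<noteq> {}" "A \<subseteq> D"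
  obtains c where "c \<in> A" "\<forall>\<^sub>F n in sequentially. A \<subseteq> H c n"
proof -
  obtain c where "c \<in> A" "A \<subseteq> under c"
    using finite_has_greatest[of A] assms(2-5) by blast
  then have "coherent_exhaustion r H (under c) (H c)" using exhaust \<open>A \<subseteq> D\<close> by blast
  then have "\<forall>\<^sub>F n in sequentially. A \<subseteq> H c n"
    using \<open>A \<subseteq> under c\<close> \<open>finite A\<close>
    by (intro eventually_finite_subset_mono_Union) (simp_all add: coherent_exhaustion_def)
  with \<open>c \<in> A\<close> that show thesis by blast
qed

lemma coherent_exhaustion_enumeration:
  assumes "countable D" "D \<noteq> {}" "D \<subseteq> Field r"
    and exhaust: "\<And>x. x \<in> D \<Longrightarrow> coherent_exhaustion r H (under x) (H x)"
  obtains d g :: "nat \<Rightarrow> 'a" and N :: "nat \<Rightarrow> nat"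
  where "range d = D" "\<And>k. g k \<in> d ` {..k}"
    "\<And>k n. N k \<le> n \<Longrightarrow> d ` {..k} \<subseteq> H (g k) n"
proof -
  define d where "d = from_nat_into D"
  have range_d: "range d = D"
    using \<open>countable D\<close> \<open>D \<noteq> {}\<close> by (simp add: d_def)
  have "\<exists>c N. c \<in> d ` {..k} \<and> (\<forall>n\<ge>N. d ` {..k} \<subseteq> H c n)" for k
  proof -
    have "d ` {..k} \<subseteq> D" using range_d by blast
    then obtain c where "c \<in> d ` {..k}" "\<forall>\<^sub>F n in sequentially. d ` {..k} \<subseteq> H c n"
      using coherent_exhaustion_eventually_subset[of D H "d ` {..k}"] exhaust \<open>D \<subseteq> Field r\<close>
      by blast
    then show ?thesis unfolding eventually_sequentially by blast
  qed
  then obtain g N where "\<And>k. g k \<in> d ` {..k}" "\<And>k n. N k \<le> n \<Longrightarrow> d ` {..k} \<subseteq> H (g k) n"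
    by metis
  with range_d show thesis by (rule that)
qed

lemma coherent_exhaustion_exists:
  assumes "countable D" "ofilter D"
    and exhaust: "\<And>x. x \<in> D \<Longrightarrow> coherent_exhaustion r H (under x) (H x)"
  shows "\<exists>C. coherent_exhaustion r H D C"
proof (cases "D = {}")
  case True
  then have "coherent_exhaustion r H D (\<lambda>_. {})"
    by (simp add: coherent_exhaustion_def coherent_def mono_def)
  then show ?thesis by blast
next
  case False
  have "D \<subseteq> Field r" using \<open>ofilter D\<close> by (simp add: ofilter_def)
  then obtain d g :: "nat \<Rightarrow> 'a" and N
    where range_d: "range d = D" and g_mem: "\<And>k. g k \<in> d ` {..k}"
    and eventually_subset: "\<And>k n. N k \<le> n \<Longrightarrow> d ` {..k} \<subseteq> H (g k) n"
    using coherent_exhaustion_enumeration[OF \<open>countable D\<close> False] exhaust by metis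
  have "g k \<in> D" for k using g_mem range_d by blast
  then have exhaust_g: "coherent_exhaustion r H (under (g k)) (H (g k))" for k
    by (rule exhaust)
  have "H (g j) n \<subseteq> H (g k) n" if "j \<le> k" "N k \<le> n" for j k n
  proof -
    have "g j \<in> H (g k) n" using g_mem[of j] eventually_subset[of k n] that by fastforce
    moreover have "coherent r H n (H (g k) n)"
      using exhaust_g by (simp add: coherent_exhaustion_def)
    ultimately show ?thesis by (intro coherent_imp_level_subset)
  qed
  then have "\<exists>C. coherent_exhaustion r H (\<Union>k. under (g k)) C"
    using coherent_exhaustion_UN[of r H "\<lambda>k. under (g k)" "\<lambda>k. H (g k)" N] exhaust_g by blast
  moreover have "(\<Union>k. under (g k)) = D"
  proof
    show "(\<Union>k. under (g k)) \<subseteq> D"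
      using \<open>\<And>k. g k \<in> D\<close> \<open>ofilter D\<close> by (auto simp: ofilter_def)
    have "d k \<in> under (g k)" for k
      using eventually_subset[of k "N k"] exhaust_g[of k] unfolding coherent_exhaustion_def by blast
    then show "D \<subseteq> (\<Union>k. under (g k))" using range_d by blast
  qed
  ultimately show ?thesis by simp
qed

lemma coherent_exhaustion_insert:
  assumes "y \<in> Field r" and C: "coherent_exhaustion r H (underS y) C"
    and H_y: "\<And>n. H y n = insert y (C n)"
  shows "coherent_exhaustion r H (under y) (H y)"
  unfolding coherent_exhaustion_def
proof (intro conjI allI)
  have under_y: "under y = insert y (underS y)"
    using Refl_under_underS[OF REFL \<open>y \<in> Field r\<close>] by blast
  have C_subset: "C n \<subseteq> underS y" for n using C by (auto simp: coherent_exhaustion_def)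
  show "mono (H y)" using C by (fastforce simp: coherent_exhaustion_def mono_def H_y)
  show "(\<Union>n. H y n) = under y" using C by (auto simp: coherent_exhaustion_def H_y under_y)
  show "finite (H y n)" for n using C by (simp add: coherent_exhaustion_def H_y)
  show "coherent r H n (H y n)" for n
    unfolding coherent_def
  proof
    fix z assume "z \<in> H y n"
    then consider (top) "z = y" | (below) "z \<in> C n" by (auto simp: H_y)
    then show "H y n \<inter> under z = H z n"
    proof cases
      case top
      then show ?thesis using C_subset by (auto simp: H_y under_y)
    next
      case below
      have "y \<notin> under z"
        using below C_subset[of n] ANTISYM by (auto simp: under_def underS_def dest: antisymD)
      then have "H y n \<inter> under z = C n \<inter> under z" by (simp add: H_y)
      also have "\<dots> = H z n" using C below by (intro coherentD) (simp_all add: coherent_exhaustion_def)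
      finally show ?thesis .
    qed
  qed
qed

end

locale coherent_approximation = wo_rel r for r :: "'a rel" +
  fixes H :: "'a \<Rightarrow> nat \<Rightarrow> 'a set"
  assumes self_mem: "y \<in> Field r \<Longrightarrow> y \<in> H y n"
    and exhaustion: "y \<in> Field r \<Longrightarrow> coherent_exhaustion r H (under y) (H y)"

lemma (in wo_rel) coherent_approximation_exists:
  assumes countable: "\<And>y. y \<in> Field r \<Longrightarrow> countable (underS y)"
  shows "\<exists>H. coherent_approximation r H"
proof -
  define step where
    "step f y n = insert y ((SOME C. coherent_exhaustion r f (underS y) C) n)" for f y n
  define H where "H = worec step"
  have "adm_wo step"
    unfolding adm_wo_def
  proof (intro allI impI)
    fix f g :: "'a \<Rightarrow> nat \<Rightarrow> 'a set" and y
    assume "\<forall>x\<in>underS y. f x = g x"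
    then have "coherent_exhaustion r f (underS y) = coherent_exhaustion r g (underS y)"
      by (intro coherent_exhaustion_cong) blast
    then show "step f y = step g y" by (simp add: step_def fun_eq_iff)
  qed
  from worec_fixpoint[OF this] have H: "H = step H" by (simp add: H_def)
  have "y \<in> Field r \<longrightarrow> coherent_exhaustion r H (under y) (H y)" for y
  proof (induction y rule: well_order_induct[case_names less])
    case (less y)
    show ?case
    proof
      assume "y \<in> Field r"
      have "coherent_exhaustion r H (under x) (H x)" if "x \<in> underS y" for x
        using less that by (auto simp: underS_def Field_def)
      then have "\<exists>C. coherent_exhaustion r H (underS y) C"
        using countable[OF \<open>y \<in> Field r\<close>] underS_ofilter by (intro coherent_exhaustion_exists)
      then have "coherent_exhaustion r H (underS y) (SOME C. coherent_exhaustion r H (underS y) C)"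
        by (rule someI_ex)
      moreover have "H y n = insert y ((SOME C. coherent_exhaustion r H (underS y) C) n)" for n
        by (subst H) (simp add: step_def)
      ultimately show "coherent_exhaustion r H (under y) (H y)"
        by (rule coherent_exhaustion_insert[OF \<open>y \<in> Field r\<close>])
    qed
  qed
  moreover have "y \<in> H y n" for y n by (subst H) (simp add: step_def)
  ultimately have "coherent_approximation r H" by unfold_locales simp_all
  then show ?thesis by blast
qed

section \<open>The family of a coherent approximation\<close>

context coherent_approximation
begin

lemma H_mono: "y \<in> Field r \<Longrightarrow> mono (H y)"
  and H_Union: "y \<in> Field r \<Longrightarrow> (\<Union>n. H y n) = under y"
  and H_finite: "y \<in> Field r \<Longrightarrow> finite (H y n)"
  and H_coherent: "y \<in> Field r \<Longrightarrow> coherent r H n (H y n)"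
  using exhaustion by (simp_all add: coherent_exhaustion_def)

lemma H_subset_under: "y \<in> Field r \<Longrightarrow> H y n \<subseteq> under y"
  using H_Union by blast

definition approximants :: "'a set set" where
  "approximants = insert {} {H y n |y n. y \<in> Field r}"

lemma empty_mem_approximants: "{} \<in> approximants"
  by (simp add: approximants_def)

lemma mem_approximants: "y \<in> Field r \<Longrightarrow> H y n \<in> approximants"
  by (auto simp: approximants_def)

lemma approximants_finite_subset_Field:
  assumes "B \<in> approximants"
  shows "finite B" "B \<subseteq> Field r"
proof -
  from assms consider (empty) "B = {}" | (approximant) y n where "B = H y n" "y \<in> Field r"
    by (auto simp: approximants_def)
  then have "finite B \<and> B \<subseteq> Field r"
  proof cases
    case approximant
    then show ?thesis
      using H_finite H_subset_under[of y n] under_Field[of r y] by simp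
  qed simp
  then show "finite B" "B \<subseteq> Field r" by simp_all
qed

lemma approximants_cofinal:
  assumes "finite A" "A \<subseteq> Field r"
  shows "\<exists>B\<in>approximants. A \<subseteq> B"
proof (cases "A = {}")
  case True
  then show ?thesis using empty_mem_approximants by blast
next
  case False
  then obtain c where "c \<in> A" "\<forall>\<^sub>F n in sequentially. A \<subseteq> H c n"
    using coherent_exhaustion_eventually_subset[OF exhaustion] assms by blast
  then obtain n where "A \<subseteq> H c n" by (auto simp: eventually_sequentially)
  then show ?thesis using mem_approximants \<open>c \<in> A\<close> \<open>A \<subseteq> Field r\<close> by blast
qed

lemma approximants_Int_under:
  assumes "B \<in> approximants" "c \<in> B"
  shows "\<exists>n. B \<inter> under c = H c n"
proof -
  obtain y n where "B = H y n" "y \<in> Field r" using assms by (auto simp: approximants_def)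
  then show ?thesis using coherentD[OF H_coherent] \<open>c \<in> B\<close> by blast
qed

lemma shattered_approximants_pair:
  assumes "b \<in> Field r" "infinite (under b)"
  obtains a where "a \<in> Field r" "a \<noteq> b" "shattered approximants {a, b}"
proof -
  have "\<not> under b \<subseteq> H b 0"
    using assms H_finite finite_subset by blast
  then obtain a where "a \<in> under b" "a \<notin> H b 0" by blast
  have "a \<in> Field r" using \<open>a \<in> under b\<close> under_Field[of r b] by blast
  have "a \<noteq> b" using \<open>a \<notin> H b 0\<close> self_mem[OF \<open>b \<in> Field r\<close>] by blast
  then have "b \<notin> under a" using \<open>a \<in> under b\<close> ANTISYM by (auto simp: under_def dest: antisymD)
  then have "b \<notin> H a 0" using H_subset_under[OF \<open>a \<in> Field r\<close>] by blast
  obtain n where "a \<in> H b n" using \<open>a \<in> under b\<close> H_Union[OF \<open>b \<in> Field r\<close>] by blast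
  let ?trace = "\<lambda>B. B \<inter> {a, b}"
  have "a \<in> H a 0" "b \<in> H b 0" "b \<in> H b n"
    using self_mem \<open>a \<in> Field r\<close> \<open>b \<in> Field r\<close> by simp_all
  then have "Pow {a, b} = ?trace ` {{}, H a 0, H b 0, H b n}"
    using \<open>a \<notin> H b 0\<close> \<open>b \<notin> H a 0\<close> \<open>a \<in> H b n\<close> by (auto simp: Pow_insert)
  also have "\<dots> \<subseteq> ?trace ` approximants"
    using empty_mem_approximants mem_approximants \<open>a \<in> Field r\<close> \<open>b \<in> Field r\<close>
    by (intro image_mono) simp
  finally have "shattered approximants {a, b}" by (simp add: shattered_iff_Pow_subset)
  with that \<open>a \<in> Field r\<close> \<open>a \<noteq> b\<close> show thesis by blast
qed

lemma not_shattered_approximants: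
  assumes "A \<subseteq> Field r" "finite A" "2 < card A"
  shows "\<not> shattered approximants A"
proof -
  have "A \<noteq> {}" using \<open>2 < card A\<close> by auto
  then obtain c where "c \<in> A" "A \<subseteq> under c"
    using finite_has_greatest assms(1,2) by blast
  then have "c \<in> Field r" using \<open>A \<subseteq> Field r\<close> by blast
  have "chain\<^sub>\<subseteq> ((\<lambda>B. B \<inter> A) ` {B \<in> approximants. c \<in> B})"
  proof (rule chain_subset_imageI)
    fix B C assume "B \<in> {B \<in> approximants. c \<in> B}" "C \<in> {B \<in> approximants. c \<in> B}"
    then obtain m n where "B \<inter> under c = H c m" "C \<inter> under c = H c n"
      using approximants_Int_under by blast
    then have "B \<inter> A = H c m \<inter> A" "C \<inter> A = H c n \<inter> A" using \<open>A \<subseteq> under c\<close> by blast+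
    moreover have "H c m \<subseteq> H c n \<or> H c n \<subseteq> H c m"
      using monoD[OF H_mono[OF \<open>c \<in> Field r\<close>]] nat_le_linear by blast
    ultimately show "B \<inter> A \<subseteq> C \<inter> A \<or> C \<inter> A \<subseteq> B \<inter> A" by blast
  qed
  then show ?thesis using \<open>c \<in> A\<close> \<open>2 < card A\<close> by (rule not_shattered_if_chain_traces)
qed

lemma vc_dim_approximants:
  assumes "uncountable (Field r)"
  shows "vc_dim (Field r) approximants = 2"
proof -
  obtain b where "b \<in> Field r" "infinite (under b)"
    using assms countable_Field_if_finite_under by blast
  then obtain a where "a \<in> Field r" "a \<noteq> b" "shattered approximants {a, b}"
    by (rule shattered_approximants_pair)
  then have "vc_dim (Field r) approximants = enat 2"
    using \<open>b \<in> Field r\<close> not_shattered_approximants by (intro vc_dim_eqI[of "{a, b}"]) simp_all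
  then show ?thesis by (simp add: numeral_eq_enat)
qed

end

theorem theorem3p8:
  shows "\<exists>F :: nat set set set.
           (\<forall>B\<in>F. finite B \<and> B \<subseteq> omega1) \<and>
           (\<forall>A. finite A \<and> A \<subseteq> omega1 \<longrightarrow> (\<exists>B\<in>F. A \<subseteq> B)) \<and>
           vc_dim omega1 F = 2"
proof -
  interpret wo_rel "cardSuc natLeq"
    using cardSuc_Card_order[OF natLeq_Card_order]
    by unfold_locales (simp add: card_order_on_def)
  have "\<exists>H. coherent_approximation (cardSuc natLeq) H"
    using countable_initial_segment_omega1
    by (intro coherent_approximation_exists) (simp add: omega1_def)
  then obtain H where "coherent_approximation (cardSuc natLeq) H" ..
  then interpret coherent_approximation "cardSuc natLeq" H .
  show ?thesis
    unfolding omega1_def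
    using approximants_finite_subset_Field approximants_cofinal
      vc_dim_approximants[OF uncountable_omega1[unfolded omega1_def]]
    by (intro exI[of _ approximants]) simp
qed

end
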